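(* Let $\alpha\ge1$ be an integer and let $G$ be a graph with chromatic number $\chi(G)\le\alpha$. Then $G$ admits a partial edge colouring using at most $3\lceil\log_2\alpha\rceil$ colours such that all edges of $G$ are satisfied, except possibly for the edges of a set $M$ of uncoloured edges forming a matching.
   Context: For an edge $e=uv$, $E[e]$ is the set of edges incident with $u$ or $v$ and $E(e)=E[e]\setminus\{e\}$. In a partial edge colouring (not all edges need be coloured), a colour $\beta$ is unique for $e$ if $\beta$ appears on some edge $e'\in E(e)$ and on no other edge of $E[e]\setminus\{e'\}$; $e$ is satisfied if such a colour exists. *)

theory Defs
  imports Complex_Main
begin

definition graph :: "'a set \<Rightarrow> 'a set set \<Rightarrow> bool" where
  "graph V E \<longleftrightarrow> finite V \<and> (\<forall>e\<in>E. e \<subseteq> V \<and> card e = 2)"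

definition proper_colouring :: "'a set \<Rightarrow> 'a set set \<Rightarrow> nat \<Rightarrow> ('a \<Rightarrow> nat) \<Rightarrow> bool" where
  "proper_colouring V E k c \<longleftrightarrow>
     (\<forall>v\<in>V. c v < k) \<and> (\<forall>u v. {u, v} \<in> E \<longrightarrow> c u \<noteq> c v)"

definition chromatic_number :: "'a set \<Rightarrow> 'a set set \<Rightarrow> nat" where
  "chromatic_number V E = (LEAST k. \<exists>c. proper_colouring V E k c)"

definition closed_nbhd :: "'a set set \<Rightarrow> 'a set \<Rightarrow> 'a set set" where
  "closed_nbhd E e = {f \<in> E. f \<inter> e \<noteq> {}}"

definition open_nbhd :: "'a set set \<Rightarrow> 'a set \<Rightarrow> 'a set set" where
  "open_nbhd E e = closed_nbhd E e - {e}"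

text \<open>Partial edge colouring: col e = None means e is uncoloured.\<close>
definition unique_colour :: "'a set set \<Rightarrow> ('a set \<Rightarrow> nat option) \<Rightarrow> 'a set \<Rightarrow> nat \<Rightarrow> bool" where
  "unique_colour E col e \<beta> \<longleftrightarrow>
     (\<exists>e'\<in>open_nbhd E e. col e' = Some \<beta> \<and>
        (\<forall>e''\<in>closed_nbhd E e - {e'}. col e'' \<noteq> Some \<beta>))"

definition satisfied :: "'a set set \<Rightarrow> ('a set \<Rightarrow> nat option) \<Rightarrow> 'a set \<Rightarrow> bool" where
  "satisfied E col e \<longleftrightarrow> (\<exists>\<beta>. unique_colour E col e \<beta>)"

definition matching :: "'a set set \<Rightarrow> bool" where
  "matching M \<longleftrightarrow> (\<forall>e\<in>M. \<forall>f\<in>M. e \<noteq> f \<longrightarrow> e \<inter> f = {})"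

end

theory Submission
  imports Defs
begin

text \<open>
  For a bipartite graph with sides \<open>A\<close> and \<open>B\<close>, call \<open>b \<in> B\<close> bad if it is a leaf and its neighbour
  has no other leaf. The edges at bad vertices form a matching and stay uncoloured. Let \<open>S \<subseteq> A\<close> be
  minimal such that every good vertex has a neighbour in \<open>S\<close>; then each \<open>a \<in> S\<close> has a good
  neighbour \<open>p a\<close> adjacent to no other vertex of \<open>S\<close>. Colour 0 goes to the edges from \<open>a\<close> to \<open>p a\<close>,
  colour 1 to one further edge next to each of these, and colour 2 to one edge into \<open>S\<close> at every
  other good vertex, unless that edge is coloured already. Then all edges at good vertices are satisfied.

  In general take a proper vertex colouring \<open>c\<close> with minimal sum, so that every vertex sees all
  smaller colours, and split the edges by the top binary digit in which the colours of their ends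
  differ. Each of these classes is bipartite and is coloured with its own three colours. Except for
  digit 0, an end whose digit is 1 sees at least two colours that agree with its own above that
  digit and have digit 0 there, so it is not a leaf. Hence uncoloured matching edges arise only at
  digit 0.
\<close>

section \<open>Three colours for one bipartite graph\<close>

text \<open>The counterpart of \<open>satisfied\<close> when the edges of a bipartite graph are represented as ordered pairs.\<close>
definition satisfied_pair ::
    "('a \<times> 'b) set \<Rightarrow> ('a \<Rightarrow> 'b \<Rightarrow> nat option) \<Rightarrow> 'a \<Rightarrow> 'b \<Rightarrow> bool" where
  "satisfied_pair R \<kappa> a b \<longleftrightarrow>
     (\<exists>\<beta> a' b'. (a', b') \<in> R \<and> (a', b') \<noteq> (a, b) \<and> (a' = a \<or> b' = b) \<and> \<kappa> a' b' = Some \<beta> \<and>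
         (\<forall>x y. (x, y) \<in> R \<and> (x = a \<or> y = b) \<and> \<kappa> x y = Some \<beta> \<longrightarrow> (x, y) = (a', b')))"

text \<open>\<open>M\<close> collects the pairs at bad vertices. Such a second end is a leaf, and
  two bad leaves never share a neighbour, so \<open>M\<close> is a matching. The leaf clause is part
  of the conclusion because it later excludes uncoloured edges at the higher digits.\<close>

lemma bipartite_relation_colouring:
  fixes R :: "('a \<times> 'b) set"
  assumes "finite R"
  shows "\<exists>M. \<exists>\<kappa> :: 'a \<Rightarrow> 'b \<Rightarrow> nat option. M \<subseteq> R \<and> (\<forall>x y k. \<kappa> x y = Some k \<longrightarrow> k < 3) \<and>
    (\<forall>a b. (a, b) \<in> M \<longrightarrow> \<kappa> a b = None) \<and>
    (\<forall>a b x. (a, b) \<in> M \<longrightarrow> (x, b) \<in> R \<longrightarrow> x = a) \<and>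
    (\<forall>a b y. (a, b) \<in> M \<longrightarrow> (a, y) \<in> M \<longrightarrow> y = b) \<and>
    (\<forall>a b. (a, b) \<in> R - M \<longrightarrow> satisfied_pair R \<kappa> a b)"
proof -
  \<comment> \<open>The good vertices: for a leaf \<open>b\<close> with neighbour \<open>a\<close>,
    the second disjunct asks for another leaf \<open>b'\<close> at \<open>a\<close>.\<close>
  define B where "B = {b \<in> Range R. \<forall>a. (a, b) \<in> R \<longrightarrow>
     (\<exists>a'. a' \<noteq> a \<and> (a', b) \<in> R) \<or>
     (\<exists>b'. b' \<noteq> b \<and> (a, b') \<in> R \<and> (\<forall>a'. (a', b') \<in> R \<longrightarrow> a' = a))}"
  have bad: "(\<forall>x. (x, b) \<in> R \<longrightarrow> x = a) \<and> (\<forall>y. (a, y) \<in> R \<longrightarrow> y \<noteq> b \<longrightarrow> (\<exists>x. (x, y) \<in> R \<and> x \<noteq> a))"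
    if ab: "(a, b) \<in> R" "b \<notin> B" for a b
  proof -
    obtain a0 where a0: "\<forall>x. (x, b) \<in> R \<longrightarrow> x = a0"
        "\<forall>y. (a0, y) \<in> R \<longrightarrow> y \<noteq> b \<longrightarrow> (\<exists>x. (x, y) \<in> R \<and> x \<noteq> a0)"
      using ab unfolding B_def mem_Collect_eq Range_iff by metis
    moreover have "a = a0"
      using a0(1) ab(1) by blast
    ultimately show ?thesis
      by simp
  qed
  define D where "D = {S \<in> Pow (Domain R). \<forall>b\<in>B. \<exists>a\<in>S. (a, b) \<in> R}"
  have "finite D"
    unfolding D_def using assms by (simp add: finite_Domain)
  moreover have "Domain R \<in> D"
    unfolding D_def B_def by auto
  ultimately obtain S where S: "S \<in> D" "\<And>T. T \<in> D \<Longrightarrow> T \<subseteq> S \<Longrightarrow> S = T"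
    using finite_has_minimal[of D] by blast
  have dom: "\<forall>b\<in>B. \<exists>a. a \<in> S \<and> (a, b) \<in> R"
    using S(1) unfolding D_def by blast
  then obtain f where f: "\<And>b. b \<in> B \<Longrightarrow> f b \<in> S \<and> (f b, b) \<in> R"
    by metis
  \<comment> \<open>Minimality of \<open>S\<close>: removing \<open>a\<close> leaves some good
    vertex without a neighbour in \<open>S\<close>, so \<open>a\<close> was its only one.\<close>
  have "\<forall>a\<in>S. \<exists>b. b \<in> B \<and> (a, b) \<in> R \<and> (\<forall>a'\<in>S. (a', b) \<in> R \<longrightarrow> a' = a)"
  proof
    fix a assume a: "a \<in> S"
    then have "S - {a} \<notin> D"
      using S(2)[of "S - {a}"] by blast
    moreover have "S - {a} \<in> Pow (Domain R)"
      using S(1) unfolding D_def by blast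
    ultimately obtain b where "b \<in> B" "\<forall>a'\<in>S - {a}. (a', b) \<notin> R"
      unfolding D_def by blast
    then show "\<exists>b. b \<in> B \<and> (a, b) \<in> R \<and> (\<forall>a'\<in>S. (a', b) \<in> R \<longrightarrow> a' = a)"
      using dom by blast
  qed
  then obtain p where p: "\<And>a. a \<in> S \<Longrightarrow> p a \<in> B" "\<And>a. a \<in> S \<Longrightarrow> (a, p a) \<in> R"
    and only_in_S: "\<And>a a'. a \<in> S \<Longrightarrow> a' \<in> S \<Longrightarrow> (a', p a) \<in> R \<Longrightarrow> a' = a"
    by metis
  \<comment> \<open>The candidates for colour 1, which serves the edge from \<open>a\<close> to
    \<open>p a\<close>. Either \<open>p a\<close> has a second neighbour, necessarily outside
    \<open>S\<close>, or \<open>p a\<close> is a leaf and, being good, shares \<open>a\<close> with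
    another leaf.\<close>
  define next_edge where "next_edge a e \<longleftrightarrow> e \<in> R \<and> snd e \<in> B \<and> e \<noteq> (a, p a) \<and>
      (fst e \<notin> S \<and> snd e = p a \<or> fst e = a \<and> (\<forall>a'. (a', snd e) \<in> R \<longrightarrow> a' = a))" for a e
  have "\<forall>a\<in>S. \<exists>e. next_edge a e"
  proof
    fix a assume a: "a \<in> S"
    show "\<exists>e. next_edge a e"
    proof (cases "\<exists>a'. a' \<noteq> a \<and> (a', p a) \<in> R")
      case True
      then obtain a' where a': "a' \<noteq> a" "(a', p a) \<in> R"
        by blast
      then have "a' \<notin> S"
        using only_in_S a by blast
      then show ?thesis
        using a' p(1)[OF a] unfolding next_edge_def by (intro exI[of _ "(a', p a)"]) auto
    next
      case False
      then obtain b' where b': "b' \<noteq> p a" "(a, b') \<in> R" "\<forall>a'. (a', b') \<in> R \<longrightarrow> a' = a"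
        using p[OF a] unfolding B_def mem_Collect_eq by metis
      have "\<forall>a'. (a', p a) \<in> R \<longrightarrow> a' = a"
        using False by blast
      \<comment> \<open>The leaf \<open>b'\<close> is good in turn, since \<open>p a\<close> is
        another leaf at \<open>a\<close>.\<close>
      then have "\<exists>b''. b'' \<noteq> b' \<and> (a, b'') \<in> R \<and> (\<forall>a'. (a', b'') \<in> R \<longrightarrow> a' = a)"
        using b'(1) p(2)[OF a] by (intro exI[of _ "p a"]) simp
      then have "b' \<in> B"
        unfolding B_def mem_Collect_eq using b'(2,3) by (metis RangeI)
      then have "next_edge a (a, b')"
        unfolding next_edge_def fst_conv snd_conv prod.inject using b' by blast
      then show ?thesis ..
    qed
  qed
  then obtain g where next_g: "\<And>a. a \<in> S \<Longrightarrow> next_edge a (g a)"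
    by metis
  have g: "g a \<in> R" "snd (g a) \<in> B" "g a \<noteq> (a, p a)"
    and g_cases: "fst (g a) \<notin> S \<and> snd (g a) = p a \<or>
        fst (g a) = a \<and> (\<forall>a'. (a', snd (g a)) \<in> R \<longrightarrow> a' = a)" if "a \<in> S" for a
    using next_g[OF that] unfolding next_edge_def by simp_all
  \<comment> \<open>The order of the tests gives 0 priority over 1 and 1 over 2. Every edge coloured
    2 starts in \<open>S\<close>, since \<open>f\<close> takes its values there on
    \<open>B\<close>.\<close>
  define \<kappa> :: "'a \<Rightarrow> 'b \<Rightarrow> nat option" where
    "\<kappa> x y = (if x \<in> S \<and> y = p x then Some 0
       else if \<exists>a\<in>S. g a = (x, y) then Some 1
       else if y \<in> B \<and> f y = x then Some 2 else None)" for x y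
  have \<kappa>0: "\<kappa> x y = Some 0 \<longleftrightarrow> x \<in> S \<and> y = p x" for x y
    unfolding \<kappa>_def by auto
  have \<kappa>1: "\<kappa> x y = Some 1 \<longleftrightarrow> \<not> (x \<in> S \<and> y = p x) \<and> (\<exists>a\<in>S. g a = (x, y))" for x y
    unfolding \<kappa>_def by auto
  have \<kappa>2: "\<kappa> x y = Some 2 \<longleftrightarrow>
      \<not> (x \<in> S \<and> y = p x) \<and> \<not> (\<exists>a\<in>S. g a = (x, y)) \<and> y \<in> B \<and> f y = x" for x y
    unfolding \<kappa>_def by auto
  show ?thesis
  proof (intro exI[of _ "{(a, b) \<in> R. b \<notin> B}"] exI[of _ \<kappa>] conjI allI impI)
    show "{(a, b) \<in> R. b \<notin> B} \<subseteq> R"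
      by blast
    show "k < 3" if "\<kappa> x y = Some k" for x y k
      using that unfolding \<kappa>_def by (auto split: if_splits)
    show "\<kappa> a b = None" if "(a, b) \<in> {(a, b) \<in> R. b \<notin> B}" for a b
      using that p(1) g(2) unfolding \<kappa>_def by (metis (no_types, lifting) case_prodD mem_Collect_eq snd_conv)
    show "x = a" if "(a, b) \<in> {(a, b) \<in> R. b \<notin> B}" "(x, b) \<in> R" for a b x
      using that bad[of a b] by simp
    show "y = b" if "(a, b) \<in> {(a, b) \<in> R. b \<notin> B}" "(a, y) \<in> {(a, b) \<in> R. b \<notin> B}" for a b y
      using that bad[of a b] bad[of a y] by auto
  next
    fix a b assume "(a, b) \<in> R - {(a, b) \<in> R. b \<notin> B}"
    then have ab: "(a, b) \<in> R" "b \<in> B"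
      by auto
    let ?sat = "\<lambda>\<beta> a' b'. (a', b') \<in> R \<and> (a', b') \<noteq> (a, b) \<and> (a' = a \<or> b' = b) \<and> \<kappa> a' b' = Some \<beta> \<and>
         (\<forall>x y. (x, y) \<in> R \<and> (x = a \<or> y = b) \<and> \<kappa> x y = Some \<beta> \<longrightarrow> (x, y) = (a', b'))"
    \<comment> \<open>The unique colours are 0 on \<open>(a, p a)\<close>, 1 on \<open>g a\<close>,
      0 on \<open>(a', b)\<close> and 2 on \<open>(f b, b)\<close>, in this order.\<close>
    consider "a \<in> S" "b \<noteq> p a" | "a \<in> S" "b = p a"
      | a' where "a \<notin> S" "a' \<in> S" "b = p a'" | "a \<notin> S" "b \<notin> p ` S"
      by blast
    then have "\<exists>\<beta> a' b'. ?sat \<beta> a' b'"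
    proof cases
      case 1
      then have "?sat 0 a (p a)"
        using p(2) only_in_S ab unfolding \<kappa>0 by blast
      then show ?thesis by blast
    next
      case 2
      obtain x y where xy: "g a = (x, y)"
        by fastforce
      have not0: "\<not> (x \<in> S \<and> y = p x)"
        using g(3)[OF 2(1)] g_cases[OF 2(1)] xy by auto
      \<comment> \<open>A pair coloured 1 that meets \<open>(a, p a)\<close> is \<open>g a'\<close>
        for some \<open>a'\<close> in \<open>S\<close>. If it starts outside \<open>S\<close>, it
        must end in \<open>p a\<close>, so \<open>p a = p a'\<close>; otherwise its second end is a
        leaf at \<open>a'\<close>. Both force \<open>a' = a\<close>.\<close>
      have "(u, v) = (x, y)" if uv: "(u, v) \<in> R" "u = a \<or> v = b" "\<kappa> u v = Some 1" for u v
      proof -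
        obtain a' where a': "a' \<in> S" "g a' = (u, v)"
          using uv(3) unfolding \<kappa>1 by blast
        have "a' = a"
          using g_cases[OF a'(1)]
        proof
          assume "fst (g a') \<notin> S \<and> snd (g a') = p a'"
          then have "u \<notin> S" "v = p a'"
            using a'(2) by simp_all
          then have "p a = p a'"
            using uv(2) 2 by auto
          with p(2)[OF a'(1)] have "(a', p a) \<in> R"
            by (simp only:)
          then show ?thesis
            by (rule only_in_S[OF 2(1) a'(1)])
        next
          assume "fst (g a') = a' \<and> (\<forall>x. (x, snd (g a')) \<in> R \<longrightarrow> x = a')"
          then have "u = a'" "\<forall>x. (x, v) \<in> R \<longrightarrow> x = a'"
            using a'(2) by simp_all
          then show ?thesis
            using uv(2) ab(1) by blast
        qed
        then show ?thesis
          using a' xy by simp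
      qed
      moreover have "(x, y) \<in> R" "(x, y) \<noteq> (a, b)"
        using g(1,3)[OF 2(1)] xy 2(2) by simp_all
      moreover have "x = a \<or> y = b"
        using g_cases[OF 2(1)] xy 2(2) by auto
      moreover have "\<kappa> x y = Some 1"
        unfolding \<kappa>1 using not0 xy 2(1) by blast
      ultimately have "?sat 1 x y"
        by blast
      then show ?thesis by blast
    next
      case 3
      have "(x, y) = (a', b)" if "(x, y) \<in> R" "x = a \<or> y = b" "x \<in> S \<and> y = p x" for x y
      proof -
        have "y = b"
          using that 3(1) by blast
        moreover from this have "x = a'"
          using only_in_S[OF 3(2), of x] that 3(3) by simp
        ultimately show ?thesis by simp
      qed
      moreover have "(a', b) \<in> R" "a' \<noteq> a"
        using 3 p(2) by auto
      ultimately have "?sat 0 a' b"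
        using 3 unfolding \<kappa>0 by simp
      then show ?thesis by blast
    next
      case 4
      \<comment> \<open>If \<open>g a'\<close> ended in \<open>b\<close>, then either
        \<open>b = p a'\<close>, or \<open>b\<close> would be a leaf at \<open>a'\<close> and so
        \<open>a = a'\<close> would lie in \<open>S\<close>.\<close>
      have "\<not> (\<exists>a'\<in>S. g a' = (f b, b))"
      proof
        assume "\<exists>a'\<in>S. g a' = (f b, b)"
        then obtain a' where a': "a' \<in> S" "g a' = (f b, b)"
          by blast
        then have "b = p a' \<or> (\<forall>x. (x, b) \<in> R \<longrightarrow> x = a')"
          using g_cases[OF a'(1)] unfolding a'(2) fst_conv snd_conv by blast
        then show False
          using a'(1) 4 ab(1) by blast
      qed
      then have "\<kappa> (f b) b = Some 2"
        unfolding \<kappa>2 using f[OF ab(2)] ab(2) 4(2) by blast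
      moreover have "(x, y) = (f b, b)" if "x = a \<or> y = b" "\<kappa> x y = Some 2" for x y
        using that f[of y] 4(1) unfolding \<kappa>2 by auto
      moreover have "(f b, b) \<in> R" "f b \<noteq> a"
        using f[OF ab(2)] 4(1) by auto
      ultimately have "?sat 2 (f b) b"
        by blast
      then show ?thesis by blast
    qed
    then show "satisfied_pair R \<kappa> a b"
      unfolding satisfied_pair_def .
  qed
qed

text \<open>Passes from ordered pairs to two-element sets, with \<open>P\<close> marking the first
  end. The leaf of an edge in \<open>M\<close> lies on the side where \<open>P\<close>
  fails.\<close>

lemma bipartite_partial_edge_colouring:
  fixes E :: "'a set set" and P :: "'a \<Rightarrow> bool"
  assumes "finite (\<Union>E)"
    and bip: "\<And>e. e \<in> E \<Longrightarrow> \<exists>a b. e = {a, b} \<and> P a \<and> \<not> P b"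
  shows "\<exists>M. \<exists>col :: 'a set \<Rightarrow> nat option. M \<subseteq> E \<and> matching M \<and>
    (\<forall>e k. col e = Some k \<longrightarrow> k < 3) \<and> (\<forall>e\<in>M. col e = None) \<and>
    (\<forall>e\<in>M. \<exists>b\<in>e. \<not> P b \<and> (\<forall>f\<in>E. b \<in> f \<longrightarrow> f = e)) \<and>
    (\<forall>e\<in>E - M. satisfied E col e)"
proof -
  define R where "R = {(a, b). {a, b} \<in> E \<and> P a \<and> \<not> P b}"
  have "finite R"
  proof (rule finite_subset)
    show "R \<subseteq> \<Union>E \<times> \<Union>E"
      unfolding R_def by blast
    show "finite (\<Union>E \<times> \<Union>E)"
      using assms(1) by simp
  qed
  from bipartite_relation_colouring[OF this] obtain N and \<kappa> :: "'a \<Rightarrow> 'a \<Rightarrow> nat option" where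
    N: "N \<subseteq> R"
    and \<kappa>: "\<forall>x y k. \<kappa> x y = Some k \<longrightarrow> k < 3"
    and N_none: "\<forall>a b. (a, b) \<in> N \<longrightarrow> \<kappa> a b = None"
    and N_leaf: "\<forall>a b x. (a, b) \<in> N \<longrightarrow> (x, b) \<in> R \<longrightarrow> x = a"
    and N_fun: "\<forall>a b y. (a, b) \<in> N \<longrightarrow> (a, y) \<in> N \<longrightarrow> y = b"
    and sat: "\<forall>a b. (a, b) \<in> R - N \<longrightarrow> satisfied_pair R \<kappa> a b"
    by (elim exE conjE)
  \<comment> \<open>For a set that is not an edge the descriptions may be arbitrary; the bound 3
    survives because \<kappa> obeys it on all arguments.\<close>
  define col where "col e = \<kappa> (THE a. a \<in> e \<and> P a) (THE b. b \<in> e \<and> \<not> P b)" for e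
  have col: "col {a, b} = \<kappa> a b" if "P a" "\<not> P b" for a b
  proof -
    have "(THE x. x \<in> {a, b} \<and> P x) = a" "(THE x. x \<in> {a, b} \<and> \<not> P x) = b"
      using that by (auto intro!: the_equality)
    then show ?thesis
      unfolding col_def by simp
  qed
  have edge: "\<exists>a b. e = {a, b} \<and> (a, b) \<in> R" if "e \<in> E" for e
    using bip[OF that] that unfolding R_def by blast
  have R: "{a, b} \<in> E" "P a" "\<not> P b" if "(a, b) \<in> R" for a b
    using that unfolding R_def by auto
  show ?thesis
  proof (intro exI[of _ "(\<lambda>(a, b). {a, b}) ` N"] exI[of _ col] conjI allI impI ballI)
    show "(\<lambda>(a, b). {a, b}) ` N \<subseteq> E"
      using N R by auto
    show "matching ((\<lambda>(a, b). {a, b}) ` N)"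
      unfolding matching_def
    proof (clarify, rule ccontr)
      fix a b a' b'
      assume *: "(a, b) \<in> N" "(a', b') \<in> N" "{a, b} \<noteq> {a', b'}" "{a, b} \<inter> {a', b'} \<noteq> {}"
      have "(a, b) \<in> R" "(a', b') \<in> R"
        using * N by auto
      then have "a = a' \<or> b = b'"
        using * R by fastforce
      then show False
        using * N_fun N_leaf N by blast
    qed
    show "k < 3" if "col e = Some k" for e k
      using that \<kappa> unfolding col_def by blast
    show "col e = None" if "e \<in> (\<lambda>(a, b). {a, b}) ` N" for e
      using that N R col N_none by fastforce
    show "\<exists>b\<in>e. \<not> P b \<and> (\<forall>f\<in>E. b \<in> f \<longrightarrow> f = e)" if "e \<in> (\<lambda>(a, b). {a, b}) ` N" for e
    proof -
      obtain a b where ab: "e = {a, b}" "(a, b) \<in> N"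
        using \<open>e \<in> _\<close> by auto
      have b: "\<not> P b"
        using ab N R by blast
      have "f = e" if f: "f \<in> E" "b \<in> f" for f
      proof -
        obtain x y where xy: "f = {x, y}" "(x, y) \<in> R"
          using edge f by blast
        then have "y = b"
          using R f b by blast
        then show ?thesis
          using xy ab N_leaf by blast
      qed
      then show ?thesis
        using ab b by blast
    qed
  next
    fix e assume e: "e \<in> E - (\<lambda>(a, b). {a, b}) ` N"
    then obtain a b where ab: "e = {a, b}" "(a, b) \<in> R"
      using edge by blast
    then have "(a, b) \<in> R - N"
      using e by auto
    from sat[rule_format, OF this, unfolded satisfied_pair_def] obtain \<beta> a' b' where
      w: "(a', b') \<in> R" "(a', b') \<noteq> (a, b)" "a' = a \<or> b' = b" "\<kappa> a' b' = Some \<beta>"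
      and uniq: "\<And>x y. (x, y) \<in> R \<Longrightarrow> x = a \<or> y = b \<Longrightarrow> \<kappa> x y = Some \<beta> \<Longrightarrow> (x, y) = (a', b')"
      by blast
    have "{a', b'} \<noteq> e"
      using w(1,2) ab R by (metis doubleton_eq_iff)
    then have "{a', b'} \<in> open_nbhd E e"
      unfolding open_nbhd_def closed_nbhd_def using ab R[OF w(1)] w(3) by auto
    moreover have "col {a', b'} = Some \<beta>"
      using col R[OF w(1)] w(4) by simp
    moreover have "col e'' \<noteq> Some \<beta>" if "e'' \<in> closed_nbhd E e - {{a', b'}}" for e''
    proof
      assume c: "col e'' = Some \<beta>"
      have e'': "e'' \<in> E" "e'' \<inter> e \<noteq> {}" "e'' \<noteq> {a', b'}"
        using that unfolding closed_nbhd_def by auto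
      then obtain x y where xy: "e'' = {x, y}" "(x, y) \<in> R"
        using edge by blast
      have "x = a \<or> y = b"
        using e''(2) xy ab R by blast
      moreover have "\<kappa> x y = Some \<beta>"
        using c xy col R by metis
      ultimately show False
        using uniq xy e''(3) by blast
    qed
    ultimately show "satisfied E col e"
      unfolding satisfied_def unique_colour_def by blast
  qed
qed

section \<open>Proper vertex colourings and the greedy property\<close>

text \<open>An injective numbering of the finite set \<open>V\<close> is proper, so the
  \<open>LEAST\<close> in the chromatic number is attained.\<close>

lemma proper_colouring_chromatic_number:
  assumes "graph V E"
  obtains c where "proper_colouring V E (chromatic_number V E) c"
proof -
  obtain h :: "'a \<Rightarrow> nat" where h: "bij_betw h V {0..<card V}"
    using assms ex_bij_betw_finite_nat[of V] unfolding graph_def by blast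
  have "h u \<noteq> h v" if "{u, v} \<in> E" for u v
  proof -
    have "{u, v} \<subseteq> V" "card {u, v} = 2"
      using assms that unfolding graph_def by blast+
    then have "u \<in> V" "v \<in> V" "u \<noteq> v"
      by auto
    then show ?thesis
      using h unfolding bij_betw_def inj_on_def by blast
  qed
  then have "\<exists>c. proper_colouring V E (card V) c"
    using h unfolding proper_colouring_def bij_betw_def by (intro exI[of _ h]) auto
  then have "\<exists>c. proper_colouring V E (chromatic_number V E) c"
    unfolding chromatic_number_def by (rule LeastI)
  then show ?thesis
    using that by blast
qed

text \<open>In a proper colouring of minimal sum, a vertex that misses a smaller colour
  \<open>j\<close> could be recoloured with \<open>j\<close>, which lowers the sum.\<close>

lemma greedy_colouring_exists:
  assumes "graph V E" "proper_colouring V E k c"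
  obtains c' where "proper_colouring V E k c'"
    "\<And>v j. v \<in> V \<Longrightarrow> j < c' v \<Longrightarrow> \<exists>u. {u, v} \<in> E \<and> c' u = j"
proof -
  obtain c' where c': "proper_colouring V E k c'"
    and least: "\<And>d. proper_colouring V E k d \<Longrightarrow> (\<Sum>v\<in>V. c' v) \<le> (\<Sum>v\<in>V. d v)"
    using ex_has_least_nat[of "proper_colouring V E k" c "\<lambda>d. \<Sum>v\<in>V. d v"] assms(2) by blast
  have "\<exists>u. {u, v} \<in> E \<and> c' u = j" if v: "v \<in> V" and j: "j < c' v" for v j
  proof (rule ccontr)
    assume none: "\<nexists>u. {u, v} \<in> E \<and> c' u = j"
    have loop: "{v, v} \<notin> E"
      using assms(1) unfolding graph_def by fastforce
    have "proper_colouring V E k (c'(v := j))"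
      unfolding proper_colouring_def
    proof (intro conjI ballI allI impI)
      show "(c'(v := j)) x < k" if "x \<in> V" for x
        using that v j c' unfolding proper_colouring_def by (auto intro: less_trans)
      show "(c'(v := j)) x \<noteq> (c'(v := j)) y" if "{x, y} \<in> E" for x y
        using that c' none loop unfolding proper_colouring_def by (auto simp: insert_commute)
    qed
    moreover have "(\<Sum>x\<in>V. (c'(v := j)) x) < (\<Sum>x\<in>V. c' x)"
      using assms(1) v j unfolding graph_def by (intro sum_strict_mono_ex1) auto
    ultimately show False
      using least by (meson not_less)
  qed
  with c' that show ?thesis
    by blast
qed

section \<open>Combining the classes given by binary digits\<close>

lemma div_power2_eq_mono:
  fixes x y :: nat
  assumes "x div 2 ^ i = y div 2 ^ i" "i \<le> j"
  shows "x div 2 ^ j = y div 2 ^ j"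
proof -
  have "(2::nat) ^ j = 2 ^ i * 2 ^ (j - i)"
    using assms(2) by (simp flip: power_add)
  then show ?thesis
    using assms(1) by (simp add: div_mult2_eq)
qed

text \<open>Uniqueness survives inside \<open>F\<close> because \<open>h\<close> is injective, and
  edges outside \<open>F\<close> cannot spoil it because they share no colour with
  \<open>F\<close>.\<close>

lemma satisfied_supergraph:
  assumes "satisfied F col e" "F \<subseteq> E"
    and "\<And>f. f \<in> F \<Longrightarrow> col' f = map_option h (col f)" "inj h"
    and "\<And>f g k. f \<in> E - F \<Longrightarrow> g \<in> F \<Longrightarrow> col' g = Some k \<Longrightarrow> col' f \<noteq> Some k"
  shows "satisfied E col' e"
proof -
  obtain \<beta> e' where e': "e' \<in> open_nbhd F e" "col e' = Some \<beta>"
    and uniq: "\<And>e''. e'' \<in> closed_nbhd F e - {e'} \<Longrightarrow> col e'' \<noteq> Some \<beta>"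
    using assms(1) unfolding satisfied_def unique_colour_def by blast
  have "e' \<in> open_nbhd E e" "e' \<in> F"
    using e'(1) assms(2) unfolding open_nbhd_def closed_nbhd_def by auto
  moreover have "col' e' = Some (h \<beta>)"
    using e'(2) assms(3) \<open>e' \<in> F\<close> by simp
  moreover have "col' e'' \<noteq> Some (h \<beta>)" if e'': "e'' \<in> closed_nbhd E e - {e'}" for e''
  proof (cases "e'' \<in> F")
    case True
    then have "e'' \<in> closed_nbhd F e - {e'}"
      using e'' unfolding closed_nbhd_def by blast
    then show ?thesis
      using uniq assms(3)[OF True] \<open>inj h\<close> by (auto dest: injD)
  next
    case False
    then show ?thesis
      using e'' assms(5) \<open>e' \<in> F\<close> \<open>col' e' = Some (h \<beta>)\<close> unfolding closed_nbhd_def by blast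
  qed
  ultimately show ?thesis
    unfolding satisfied_def unique_colour_def by blast
qed

theorem mainTheorem9:
  fixes V :: "'a set" and E :: "'a set set" and \<alpha> :: nat
  assumes "graph V E" and "\<alpha> \<ge> 1" and "chromatic_number V E \<le> \<alpha>"
  shows "\<exists>col :: 'a set \<Rightarrow> nat option. \<exists>M.
           card (Option.these (col ` E)) \<le> 3 * nat \<lceil>log 2 (real \<alpha>)\<rceil> \<and>
           M \<subseteq> E \<and> matching M \<and> (\<forall>e\<in>M. col e = None) \<and>
           (\<forall>e\<in>E - M. satisfied E col e)"
proof -
  define n where "n = nat \<lceil>log 2 (real \<alpha>)\<rceil>"
  have "log 2 (real \<alpha>) \<le> real n"
    unfolding n_def by linarith
  then have "real \<alpha> \<le> 2 powr real n"
    using assms(2) by (simp add: log_le_iff)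
  then have "real \<alpha> \<le> real (2 ^ n)"
    by (simp add: powr_realpow)
  then have \<alpha>: "\<alpha> \<le> 2 ^ n"
    by (simp only: of_nat_le_iff)
  obtain c where c: "proper_colouring V E (chromatic_number V E) c"
    and greedy: "\<And>v j. v \<in> V \<Longrightarrow> j < c v \<Longrightarrow> \<exists>u. {u, v} \<in> E \<and> c u = j"
    by (metis proper_colouring_chromatic_number[OF assms(1)] greedy_colouring_exists[OF assms(1)])
  have c_less: "c v < 2 ^ n" if "v \<in> V" for v
    using c that assms(3) \<alpha> unfolding proper_colouring_def by (meson less_le_trans)
  have c_neq: "c u \<noteq> c v" if "{u, v} \<in> E" for u v
    using c that unfolding proper_colouring_def by blast
  have EV: "e \<subseteq> V" and edge: "\<exists>u v. e = {u, v} \<and> u \<noteq> v" if "e \<in> E" for e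
    using assms(1) that unfolding graph_def by (auto simp: card_2_iff)
  \<comment> \<open>On an edge this is one more than the top digit in which the colours of the ends
    differ, hence positive.\<close>
  define d where "d e = (LEAST k. \<forall>u\<in>e. \<forall>v\<in>e. c u div 2 ^ k = c v div 2 ^ k)" for e
  have d_Suc: "d {u, v} = Suc i"
    if "c u div 2 ^ i \<noteq> c v div 2 ^ i" "c u div 2 ^ Suc i = c v div 2 ^ Suc i" for u v i
    unfolding d_def
  proof (rule Least_equality)
    show "\<forall>x\<in>{u, v}. \<forall>y\<in>{u, v}. c x div 2 ^ Suc i = c y div 2 ^ Suc i"
      using that(2) by auto
    show "Suc i \<le> k" if "\<forall>x\<in>{u, v}. \<forall>y\<in>{u, v}. c x div 2 ^ k = c y div 2 ^ k" for k
      using that div_power2_eq_mono[of "c u" k "c v" i] \<open>c u div 2 ^ i \<noteq> c v div 2 ^ i\<close>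
      by (metis insertCI not_less_eq_eq)
  qed
  have d_E: "\<exists>i<n. d {u, v} = Suc i \<and> c u div 2 ^ i \<noteq> c v div 2 ^ i \<and>
      c u div 2 ^ Suc i = c v div 2 ^ Suc i" if uv: "{u, v} \<in> E" for u v
  proof -
    let ?Q = "\<lambda>k. c u div 2 ^ k = c v div 2 ^ k"
    have "?Q n"
      using EV[OF uv] c_less by simp
    moreover have "\<not> ?Q 0"
      using c_neq[OF uv] by simp
    ultimately obtain i where "i < n" "\<not> ?Q i" "?Q (Suc i)"
      using ex_least_nat_less[of ?Q n] by auto
    then show ?thesis
      using d_Suc by blast
  qed
  define F where "F i = {e \<in> E. d e = Suc i}" for i
  define P where "P i v = even (c v div 2 ^ i)" for i v
  have F_E: "F i \<subseteq> E" for i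
    unfolding F_def by blast
  have "finite (\<Union>(F i))" for i
    by (rule finite_subset[of _ V]) (use assms(1) EV F_E in \<open>auto simp: graph_def\<close>)
  moreover have "\<exists>a b. e = {a, b} \<and> P i a \<and> \<not> P i b" if "e \<in> F i" for e i
  proof -
    have e: "e \<in> E" "d e = Suc i"
      using that unfolding F_def by auto
    then obtain u v where uv: "e = {u, v}"
      using edge by blast
    then have "c u div 2 ^ i \<noteq> c v div 2 ^ i" "c u div 2 ^ Suc i = c v div 2 ^ Suc i"
      using d_E[of u v] e by auto
    then have "c u div 2 ^ i \<noteq> c v div 2 ^ i" "c u div 2 ^ i div 2 = c v div 2 ^ i div 2"
      by (simp_all add: power_Suc2 div_mult2_eq del: power_Suc)
    \<comment> \<open>Different quotients with equal halves differ in parity, so digit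
      \<open>i\<close> splits \<open>F i\<close> into two sides.\<close>
    then have "P i u \<noteq> P i v"
      unfolding P_def by (metis div_mult_mod_eq parity_cases)
    then show ?thesis
      using uv by (metis insert_commute)
  qed
  ultimately have "\<exists>M col. M \<subseteq> F i \<and> matching M \<and> (\<forall>e k. col e = Some k \<longrightarrow> k < (3::nat)) \<and>
      (\<forall>e\<in>M. col e = None) \<and> (\<forall>e\<in>M. \<exists>b\<in>e. \<not> P i b \<and> (\<forall>f\<in>F i. b \<in> f \<longrightarrow> f = e)) \<and>
      (\<forall>e\<in>F i - M. satisfied (F i) col e)" for i
    by (rule bipartite_partial_edge_colouring)
  then obtain col :: "nat \<Rightarrow> 'a set \<Rightarrow> nat option" and M where
    M: "\<And>i. M i \<subseteq> F i" "\<And>i. matching (M i)"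
    and col3: "\<And>i e k. col i e = Some k \<Longrightarrow> k < 3"
    and M_none: "\<And>i e. e \<in> M i \<Longrightarrow> col i e = None"
    and M_leaf: "\<And>i e. e \<in> M i \<Longrightarrow> \<exists>b\<in>e. \<not> P i b \<and> (\<forall>f\<in>F i. b \<in> f \<longrightarrow> f = e)"
    and sat: "\<And>i e. e \<in> F i - M i \<Longrightarrow> satisfied (F i) (col i) e"
    by metis
  have M_empty: "M i = {}" if "i > 0" for i
  proof (rule ccontr)
    assume "M i \<noteq> {}"
    then obtain e where e: "e \<in> M i"
      by blast
    from M_leaf[OF this] obtain b where b: "b \<in> e" "\<not> P i b"
      and leaf: "\<And>f. f \<in> F i \<Longrightarrow> b \<in> f \<Longrightarrow> f = e"
      by blast
    have "b \<in> V"
      using e b M F_E EV by blast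
    obtain t where t: "c b div 2 ^ i = 2 * t + 1"
      using b(2) unfolding P_def by (auto elim: oddE)
    \<comment> \<open>These colours lie below that of \<open>b\<close>, agree with it above digit
      \<open>i\<close> and have digit \<open>i\<close> equal to 0. The greedy property yields edges
      of \<open>F i\<close> at \<open>b\<close>, and all of them equal \<open>e\<close> because
      \<open>b\<close> is a leaf.\<close>
    have lower: "\<exists>u. {u, b} = e \<and> c u = 2 * t * 2 ^ i + s" if s: "s < 2 ^ i" for s
    proof -
      have "2 * t * 2 ^ i + s < (2 * t + 1) * 2 ^ i"
        using s by (simp add: algebra_simps)
      also have "\<dots> \<le> c b"
        by (metis t div_times_less_eq_dividend)
      finally obtain u where u: "{u, b} \<in> E" "c u = 2 * t * 2 ^ i + s"
        using greedy[OF \<open>b \<in> V\<close>] by blast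
      have "c u div 2 ^ i = 2 * t"
        using u(2) s by simp
      then have "d {u, b} = Suc i"
        using t by (intro d_Suc) (auto simp: power_Suc2 div_mult2_eq simp del: power_Suc)
      then have "{u, b} \<in> F i"
        using u(1) unfolding F_def by blast
      then show ?thesis
        using leaf u(2) by blast
    qed
    \<comment> \<open>For positive \<open>i\<close> both \<open>s = 0\<close> and
      \<open>s = 1\<close> are available, giving the other end of \<open>e\<close> two
      colours.\<close>
    have "(1::nat) < 2 ^ i"
      using \<open>i > 0\<close> by (intro one_less_power) auto
    then obtain u v where "{u, b} = e" "{v, b} = e" "c u = 2 * t * 2 ^ i + 0" "c v = 2 * t * 2 ^ i + 1"
      using lower[of 0] lower[of 1] by auto
    then show False
      by (metis doubleton_eq_iff add_left_cancel zero_neq_one)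
  qed
  \<comment> \<open>Class \<open>i\<close> gets the palette from \<open>3 * i\<close> to
    \<open>3 * i + 2\<close>; the subtraction undoes the shift by one in \<open>d\<close>.\<close>
  define C where "C e = map_option (\<lambda>k. 3 * (d e - 1) + k) (col (d e - 1) e)" for e
  have C_F: "C e = map_option (\<lambda>k. 3 * i + k) (col i e)" if "e \<in> F i" for e i
    using that unfolding C_def F_def by simp
  have F_cover: "\<exists>i<n. e \<in> F i" if "e \<in> E" for e
    using edge[OF that] d_E that unfolding F_def by blast
  show ?thesis
  proof (intro exI conjI ballI)
    have "Option.these (C ` E) \<subseteq> {..<3 * n}"
    proof
      fix k assume "k \<in> Option.these (C ` E)"
      then obtain e where e: "e \<in> E" "C e = Some k"
        by (force simp: in_these_eq)
      then obtain i where i: "i < n" "e \<in> F i"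
        using F_cover by blast
      then obtain l where "k = 3 * i + l" "l < 3"
        using C_F e(2) col3 by auto
      then show "k \<in> {..<3 * n}"
        using i(1) by simp
    qed
    then show "card (Option.these (C ` E)) \<le> 3 * nat \<lceil>log 2 (real \<alpha>)\<rceil>"
      using card_mono[of "{..<3 * n}"] unfolding n_def by fastforce
    show "M 0 \<subseteq> E" "matching (M 0)"
      using M F_E by blast+
    show "C e = None" if "e \<in> M 0" for e
      using C_F[of e 0] M(1) M_none that by auto
  next
    fix e assume e: "e \<in> E - M 0"
    then obtain i where i: "e \<in> F i"
      using F_cover by blast
    then have "e \<in> F i - M i"
      using e M_empty by (cases "i = 0") auto
    from sat[OF this] F_E C_F show "satisfied E C e"
    proof (rule satisfied_supergraph)
      show "inj (\<lambda>k. 3 * i + k)"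
        by (simp add: inj_def)
      show "C f \<noteq> Some k" if f: "f \<in> E - F i" and g: "g \<in> F i" "C g = Some k" for f g k
      proof
        assume "C f = Some k"
        moreover obtain j where "f \<in> F j" "j \<noteq> i"
          using f F_cover by blast
        ultimately obtain l where "k = 3 * j + l" "l < 3"
          using C_F col3 by auto
        moreover obtain m where "k = 3 * i + m" "m < 3"
          using g C_F col3 by auto
        ultimately show False
          using \<open>j \<noteq> i\<close> by presburger
      qed
    qed
  qed
qed

end
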